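(* Let $q\ge1$, $n\ge2$, and let $\mathbf f_n(z)=I_qz^n+A_1z^{n-1}+\cdots+A_n$ ($A_j\in\mathbb C^{q\times q}$) be a Hurwitz-type matrix polynomial with Markov parameters $(s_j)_{j\ge0}$, where $s_0,\dots,s_{n-1}$ is a Stieltjes positive sequence. Let $H_f^{(n)}$ be its block Hurwitz matrix and let $\mathcal A_n$, $\mathcal L_n$, $H_{1,j}$, $H_{2,j}$ be the block matrices defined in the context. If $n=2m$, then $$\bigl(H_f^{(2m)}\bigr)^*=\mathcal A_{2m}\,\mathcal L_{2m}^*\qquad\text{and}\qquad \det\Bigl(\bigl(H_f^{(2m)}\bigr)^*\Bigr)=\det H_{2,m-1}.$$ If $n=2m+1$, then $$\bigl(H_f^{(2m+1)}\bigr)^*=\mathcal A_{2m+1}\,\mathcal L_{2m+1}^*\qquad\text{and}\qquad \det\Bigl(\bigl(H_f^{(2m+1)}\bigr)^*\Bigr)=\det H_{1,m}.$$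
   Context: **Hurwitz-type matrix (HTM) polynomials.** Write $\mathbf f_n(z)=\mathbf h_n(z^2)+z\,\mathbf g_n(z^2)$, where for $n=2m$: $\mathbf h_n(z)=I_qz^m+A_2z^{m-1}+\cdots+A_{2m}$, $\mathbf g_n(z)=A_1z^{m-1}+A_3z^{m-2}+\cdots+A_{2m-1}$; and for $n=2m+1$: $\mathbf h_n(z)=A_1z^m+A_3z^{m-1}+\cdots+A_{2m+1}$, $\mathbf g_n(z)=I_qz^m+A_2z^{m-1}+\cdots+A_{2m}$. $\mathbf f_n$ is an HTM polynomial if there are Hermitian positive definite $q\times q$ matrices $\mathbf c_0,\dots,\mathbf c_{m-1},\mathbf d_0,\dots,\mathbf d_{m-1}$ if $n=2m$ (resp. $\mathbf c_0,\dots,\mathbf c_m,\mathbf d_0,\dots,\mathbf d_{m-1}$ if $n=2m+1$) such that, as an identity of rational matrix functions, $\mathbf g_n(z)\mathbf h_n(z)^{-1}=K_0(z)$ (resp. $\mathbf h_n(z)(z\mathbf g_n(z))^{-1}=K_0(z)$), where $K_{m-1}(z)=(z\mathbf c_{m-1}+\mathbf d_{m-1}^{-1})^{-1}$ and $K_i(z)=\bigl(z\mathbf c_i+(\mathbf d_i+K_{i+1}(z))^{-1}\bigr)^{-1}$ for $i=m-2,\dots,0$ (resp. $K_m(z)=z^{-1}\mathbf c_m^{-1}$ and $K_i(z)=\bigl(z\mathbf c_i+(\mathbf d_i+K_{i+1}(z))^{-1}\bigr)^{-1}$ for $i=m-1,\dots,0$). **Markov parameters.** The Markov parameters $s_j\in\mathbb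 C^{q\times q}$ of $\mathbf f_n$ are defined by the Laurent expansion at infinity $\sum_{j\ge0}(-1)^js_jz^{-j-1}$ of $\mathbf g_n(z)\mathbf h_n(z)^{-1}$ if $n=2m$, resp. of $\mathbf h_n(z)(z\mathbf g_n(z))^{-1}$ if $n=2m+1$. **Block Hankel matrices.** $H_{1,j}=(s_{a+b})_{a,b=0}^{j}$, $H_{2,j}=(s_{a+b+1})_{a,b=0}^{j}$. A sequence $(s_j)_{j=0}^{\kappa}$ is Stieltjes positive if $H_{1,j}$ is Hermitian positive definite whenever $2j\le\kappa$ and $H_{2,j}$ is Hermitian positive definite whenever $2j+1\le\kappa$. **Block matrices** (all with $q\times q$ blocks, $n\times n$ blocks in total). Convention: $A_0=I_q$, $A_r=0_q$ for $r<0$ or $r>n$. The block Hurwitz matrix is $H_f^{(n)}=(A_{2k-i})_{i,k=1}^{n}$, i.e. its first block row is $(A_1,A_3,A_5,\dots)$, its second is $(A_0,A_2,A_4,\dots)$, its third is $(0,A_1,A_3,\dots)$, its fourth is $(0,A_0,A_2,\dots)$, and so on. $\mathcal A_n$ is block lower triangular: for $0\le k\le\ell\le n-1$ its block in row $\ell$, column $k$ (indices from $0$) is $(-1)^kA_{2(\ell-k)}^*$, and the blocks with $k>\ell$ are $0_q$. $\mathcal L_n$ (indices from $1$): for each odd row index $2i-1\le n$, the block of $\mathcal L_n$ in row $2i-1$, column $k$ is $(-1)^{i-1}s_{k-i}$ if $k\ge i$ and $0_q$ if $k<i$; for each even row index $2i\le n$, the block in row $2i$, column $k$ is $(-1)^{i-1}I_q$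 if $k=i$ and $0_q$ otherwise. Thus the first rows are $(s_0,s_1,\dots,s_{n-1})$, $(I_q,0,\dots,0)$, $(0,-s_0,\dots,-s_{n-2})$, $(0,-I_q,0,\dots,0)$, etc. *)

theory Defs
  imports
    "HOL-Computational_Algebra.Fraction_Field"
    "Jordan_Normal_Form.Schur_Decomposition"
begin

section \<open>Matrix polynomials and rational matrix functions\<close>

text \<open>
  A monic matrix polynomial \<open>I z^n + A\<^sub>1 z^(n-1) + \<dots> + A\<^sub>n\<close> of degree \<open>n\<close> with \<open>q \<times> q\<close> coefficients is
  given by the family \<open>A\<close>; only the values \<open>A 1, \<dots>, A n\<close> are ever used.
  The index of \<open>coef\<close> is an integer, because block Hurwitz matrices refer to negative indices.
\<close>

definition coef :: "nat \<Rightarrow> nat \<Rightarrow> (nat \<Rightarrow> complex mat) \<Rightarrow> int \<Rightarrow> complex mat" where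
  "coef q n A r =
     (if r = 0 then 1\<^sub>m q else if 1 \<le> r \<and> r \<le> int n then A (nat r) else 0\<^sub>m q q)"

text \<open>The matrix polynomial \<open>B 0 * z^N + B 1 * z^(N-1) + \<dots> + B N\<close>.\<close>

definition mpoly :: "nat \<Rightarrow> nat \<Rightarrow> (nat \<Rightarrow> complex mat) \<Rightarrow> complex poly mat" where
  "mpoly q N B = mat q q (\<lambda>(i, j). \<Sum>k\<le>N. monom (B k $$ (i, j)) (N - k))"

definition f_poly :: "nat \<Rightarrow> nat \<Rightarrow> (nat \<Rightarrow> complex mat) \<Rightarrow> complex poly mat" where
  "f_poly q n A = mpoly q n (\<lambda>k. coef q n A (int k))"

definition h_poly :: "nat \<Rightarrow> nat \<Rightarrow> (nat \<Rightarrow> complex mat) \<Rightarrow> complex poly mat" where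
  "h_poly q n A =
     (if even n then mpoly q (n div 2) (\<lambda>k. coef q n A (2 * int k))
      else mpoly q (n div 2) (\<lambda>k. coef q n A (2 * int k + 1)))"

definition g_poly :: "nat \<Rightarrow> nat \<Rightarrow> (nat \<Rightarrow> complex mat) \<Rightarrow> complex poly mat" where
  "g_poly q n A =
     (if even n then mpoly q (n div 2 - 1) (\<lambda>k. coef q n A (2 * int k + 1))
      else mpoly q (n div 2) (\<lambda>k. coef q n A (2 * int k)))"

text \<open>The decomposition \<open>f(z) = h(z\<^sup>2) + z g(z\<^sup>2)\<close>; composition with \<open>monom 1 2\<close> substitutes \<open>z\<^sup>2\<close>.\<close>

lemma pcompose_monom_X2: "pcompose (monom (c :: complex) k) (monom 1 2) = monom c (2 * k)"
proof (induction k)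
  case 0
  then show ?case by (simp add: monom_0)
next
  case (Suc k)
  then show ?case by (simp add: monom_Suc pcompose_pCons monom_altdef power2_eq_square)
qed

lemma sum_parity_even:
  fixes F :: "nat \<Rightarrow> 'a :: comm_monoid_add"
  assumes "m \<ge> 1"
  shows "(\<Sum>k\<le>2*m. F k) = (\<Sum>k\<le>m. F (2*k)) + (\<Sum>k\<le>m - 1. F (2*k+1))"
  using assms
proof (induction m rule: nat_induct_at_least)
  case base
  then show ?case by (simp add: numeral_2_eq_2 ac_simps)
next
  case (Suc m)
  then obtain l where "m = Suc l" by (cases m) auto
  with Suc show ?case by (simp add: ac_simps)
qed

lemma sum_parity_odd:
  fixes F :: "nat \<Rightarrow> 'a :: comm_monoid_add"
  shows "(\<Sum>k\<le>2*m+1. F k) = (\<Sum>k\<le>m. F (2*k)) + (\<Sum>k\<le>m. F (2*k+1))"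
  by (induction m) (simp_all add: ac_simps)

lemma f_poly_split:
  assumes "n \<ge> 2"
  shows "f_poly q n A =
    map_mat (\<lambda>p. pcompose p (monom 1 2)) (h_poly q n A)
    + monom 1 1 \<cdot>\<^sub>m map_mat (\<lambda>p. pcompose p (monom 1 2)) (g_poly q n A)"
proof (cases "even n")
  case True
  then obtain m where n: "n = 2 * m" by blast
  with assms have m: "m \<ge> 1" by simp
  have split: "(\<Sum>k\<le>2*m. monom (c (int k)) (2*m - k)) =
      (\<Sum>k\<le>m. monom (c (2 * int k)) (2 * (m - k))) +
      (\<Sum>k\<le>m - 1. monom (c (2 * int k + 1)) (Suc (2 * (m - 1 - k))))" for c :: "int \<Rightarrow> complex"
    unfolding sum_parity_even[OF m]
    by (intro arg_cong2[of _ _ _ _ "(+)"] sum.cong refl arg_cong2[of _ _ _ _ monom])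
       (use m in \<open>auto simp: add.commute\<close>)
  show ?thesis
  proof (rule eq_matI, goal_cases)
    case (1 i j)
    then show ?case
      using split[of "\<lambda>r. coef q n A r $$ (i, j)"]
      by (simp add: n f_poly_def h_poly_def g_poly_def mpoly_def pcompose_sum pcompose_monom_X2
          sum_distrib_left mult_monom del: sum.atMost_Suc)
  qed (simp_all add: f_poly_def h_poly_def g_poly_def mpoly_def)
next
  case False
  then obtain m where n: "n = 2 * m + 1" using oddE by blast
  have split: "(\<Sum>k\<le>2*m+1. monom (c (int k)) (2*m + 1 - k)) =
      (\<Sum>k\<le>m. monom (c (2 * int k + 1)) (2 * (m - k))) +
      (\<Sum>k\<le>m. monom (c (2 * int k)) (Suc (2 * (m - k))))" for c :: "int \<Rightarrow> complex"
    unfolding sum_parity_odd add.commute[of "\<Sum>k\<le>m. monom (c (2 * int k + 1)) (2 * (m - k))"]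
    by (intro arg_cong2[of _ _ _ _ "(+)"] sum.cong refl arg_cong2[of _ _ _ _ monom]) (auto simp: add.commute)
  show ?thesis
  proof (rule eq_matI, goal_cases)
    case (1 i j)
    then show ?case
      using split[of "\<lambda>r. coef q n A r $$ (i, j)"]
      by (simp add: n f_poly_def h_poly_def g_poly_def mpoly_def pcompose_sum pcompose_monom_X2
          sum_distrib_left mult_monom del: sum.atMost_Suc)
  qed (simp_all add: f_poly_def h_poly_def g_poly_def mpoly_def)
qed

text \<open>
  Rational matrix functions are matrices over the field \<open>\<complex>(z)\<close>, i.e. \<open>complex poly fract\<close>.
  For singular matrices \<open>minv\<close> is unspecified, but it is only applied to matrices that are invertible
  over \<open>\<complex>(z)\<close>: monic matrix polynomials (times \<open>z\<close>), positive definite constants, and matrix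
  functions whose values at real \<open>z > 0\<close> are positive definite.
\<close>

definition minv :: "'a :: field mat \<Rightarrow> 'a mat" where
  "minv M = the (mat_inverse M)"

definition rat_z :: "complex poly fract" where
  "rat_z = Fract (monom 1 1) 1"

definition rat_mat :: "complex poly mat \<Rightarrow> complex poly fract mat" where
  "rat_mat P = map_mat (\<lambda>p. Fract p 1) P"

definition rat_const :: "complex mat \<Rightarrow> complex poly fract mat" where
  "rat_const C = rat_mat (map_mat (\<lambda>c. [:c:]) C)"

text \<open>\<open>g(z) h(z)\<inverse>\<close> for even \<open>n\<close> and \<open>h(z) (z g(z))\<inverse>\<close> for odd \<open>n\<close>.\<close>

definition rat_fun :: "nat \<Rightarrow> nat \<Rightarrow> (nat \<Rightarrow> complex mat) \<Rightarrow> complex poly fract mat" where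
  "rat_fun q n A =
     (if even n then rat_mat (g_poly q n A) * minv (rat_mat (h_poly q n A))
      else rat_mat (h_poly q n A) * minv (rat_z \<cdot>\<^sub>m rat_mat (g_poly q n A)))"

section \<open>Hurwitz-type matrix polynomials\<close>

definition hermitian_pos_def :: "nat \<Rightarrow> complex mat \<Rightarrow> bool" where
  "hermitian_pos_def N M \<longleftrightarrow>
     M \<in> carrier_mat N N \<and> mat_adjoint M = M \<and>
     (\<forall>v \<in> carrier_vec N. v \<noteq> 0\<^sub>v N \<longrightarrow> Re ((M *\<^sub>v v) \<bullet>c v) > 0)"

definition HTM :: "nat \<Rightarrow> nat \<Rightarrow> (nat \<Rightarrow> complex mat) \<Rightarrow> bool" where
  "HTM q n A \<longleftrightarrow>
    (if even n then
       (\<exists>c d K. let m = n div 2 in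
          (\<forall>i<m. hermitian_pos_def q (c i)) \<and> (\<forall>i<m. hermitian_pos_def q (d i)) \<and>
          K (m - 1) = minv (rat_z \<cdot>\<^sub>m rat_const (c (m - 1)) + minv (rat_const (d (m - 1)))) \<and>
          (\<forall>i<m - 1. K i = minv (rat_z \<cdot>\<^sub>m rat_const (c i)
                                   + minv (rat_const (d i) + K (i + 1)))) \<and>
          rat_fun q n A = K 0)
     else
       (\<exists>c d K. let m = n div 2 in
          (\<forall>i\<le>m. hermitian_pos_def q (c i)) \<and> (\<forall>i<m. hermitian_pos_def q (d i)) \<and>
          K m = inverse rat_z \<cdot>\<^sub>m minv (rat_const (c m)) \<and>
          (\<forall>i<m. K i = minv (rat_z \<cdot>\<^sub>m rat_const (c i)
                               + minv (rat_const (d i) + K (i + 1)))) \<and>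
          rat_fun q n A = K 0))"

section \<open>Markov parameters\<close>

text \<open>
  \<open>laurent_at_infinity r a\<close>: the rational function \<open>r\<close> has the Laurent expansion
  \<open>a\<^sub>0 z\<inverse> + a\<^sub>1 z\<^sup>-\<^sup>2 + \<dots>\<close> at infinity. Any representation \<open>r = p / d\<close> serves to evaluate \<open>r\<close>,
  since \<open>d\<close> has no zeros near infinity.
\<close>

definition laurent_at_infinity :: "complex poly fract \<Rightarrow> (nat \<Rightarrow> complex) \<Rightarrow> bool" where
  "laurent_at_infinity r a \<longleftrightarrow>
     (\<exists>p d. d \<noteq> 0 \<and> r = Fract p d \<and>
        (\<forall>\<^sub>F z in at_infinity. (\<lambda>j. a j / z ^ (j + 1)) sums (poly p z / poly d z)))"

definition markov_parameters ::
    "nat \<Rightarrow> nat \<Rightarrow> (nat \<Rightarrow> complex mat) \<Rightarrow> (nat \<Rightarrow> complex mat) \<Rightarrow> bool" where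
  "markov_parameters q n A s \<longleftrightarrow>
     (\<forall>j. s j \<in> carrier_mat q q) \<and>
     (\<forall>a<q. \<forall>b<q. laurent_at_infinity (rat_fun q n A $$ (a, b)) (\<lambda>j. (-1) ^ j * s j $$ (a, b)))"

section \<open>Block matrices\<close>

text \<open>
  The \<open>N \<times> N\<close> block matrix with \<open>q \<times> q\<close> blocks \<open>B i k\<close>. Block indices are counted from 0, so an
  entry whose definition counts from 1 is passed in as \<open>B (i + 1) (k + 1)\<close>.
\<close>

definition block_matrix :: "nat \<Rightarrow> nat \<Rightarrow> (nat \<Rightarrow> nat \<Rightarrow> complex mat) \<Rightarrow> complex mat" where
  "block_matrix q N B =
     mat (N * q) (N * q) (\<lambda>(i, k). B (i div q) (k div q) $$ (i mod q, k mod q))"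

definition hankel1 :: "nat \<Rightarrow> (nat \<Rightarrow> complex mat) \<Rightarrow> nat \<Rightarrow> complex mat" where
  "hankel1 q s j = block_matrix q (j + 1) (\<lambda>a b. s (a + b))"

definition hankel2 :: "nat \<Rightarrow> (nat \<Rightarrow> complex mat) \<Rightarrow> nat \<Rightarrow> complex mat" where
  "hankel2 q s j = block_matrix q (j + 1) (\<lambda>a b. s (a + b + 1))"

text \<open>Stieltjes positivity of the finite sequence \<open>s 0, \<dots>, s \<kappa>\<close>.\<close>

definition stieltjes_positive :: "nat \<Rightarrow> nat \<Rightarrow> (nat \<Rightarrow> complex mat) \<Rightarrow> bool" where
  "stieltjes_positive q \<kappa> s \<longleftrightarrow>
     (\<forall>j. 2 * j \<le> \<kappa> \<longrightarrow> hermitian_pos_def ((j + 1) * q) (hankel1 q s j)) \<and>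
     (\<forall>j. 2 * j + 1 \<le> \<kappa> \<longrightarrow> hermitian_pos_def ((j + 1) * q) (hankel2 q s j))"

definition block_hurwitz :: "nat \<Rightarrow> nat \<Rightarrow> (nat \<Rightarrow> complex mat) \<Rightarrow> complex mat" where
  "block_hurwitz q n A =
     block_matrix q n (\<lambda>i k. coef q n A (2 * int (k + 1) - int (i + 1)))"

definition cal_A :: "nat \<Rightarrow> nat \<Rightarrow> (nat \<Rightarrow> complex mat) \<Rightarrow> complex mat" where
  "cal_A q n A =
     block_matrix q n (\<lambda>l k.
       if k \<le> l then (-1) ^ k \<cdot>\<^sub>m mat_adjoint (coef q n A (2 * (int l - int k))) else 0\<^sub>m q q)"

text \<open>Rows and columns counted from 1; row \<open>r\<close> is row \<open>2i - 1\<close> or \<open>2i\<close> with \<open>i = (r + 1) div 2\<close>.\<close>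

definition cal_L_block :: "nat \<Rightarrow> (nat \<Rightarrow> complex mat) \<Rightarrow> nat \<Rightarrow> nat \<Rightarrow> complex mat" where
  "cal_L_block q s r k =
     (let i = (r + 1) div 2 in
      if odd r then (if k \<ge> i then (-1) ^ (i - 1) \<cdot>\<^sub>m s (k - i) else 0\<^sub>m q q)
      else (if k = i then (-1) ^ (i - 1) \<cdot>\<^sub>m 1\<^sub>m q else 0\<^sub>m q q))"

definition cal_L :: "nat \<Rightarrow> nat \<Rightarrow> (nat \<Rightarrow> complex mat) \<Rightarrow> complex mat" where
  "cal_L q n s = block_matrix q n (\<lambda>r k. cal_L_block q s (r + 1) (k + 1))"

end

theory Submission
  imports "HOL-Analysis.FPS_Convergence" Defs
begin

text \<open>
  Clearing the denominator in the rational matrix function and comparing Laurent coefficients at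
  infinity expresses each odd-numbered coefficient \<open>A\<^sub>2\<^sub>r\<^sub>+\<^sub>1\<close> as the convolution of the signed
  Markov parameters \<open>(-1)^t s\<^sub>t\<close> with the even-numbered coefficients (\<open>markov_recurrence\<close>). The
  denominator is a monic matrix polynomial, so it is invertible over the field of rational functions.
  The block rows of the Hurwitz matrix contain either odd-numbered or even-numbered coefficients.
  Read row by row, the convolution says precisely that the Hurwitz matrix is \<open>cal_L\<close> times
  the adjoint of \<open>cal_A\<close> (\<open>block_hurwitz_factorization\<close>). The adjoint of this identity is the
  asserted factorization.

  For the determinant, \<open>cal_A\<close> is triangular with diagonal blocks \<open>I\<close> and \<open>-I\<close>, so up to a
  sign only \<open>cal_L\<close> matters. Its rows \<open>(I, 0, \<dots>, 0)\<close>, \<open>(0, -I, 0, \<dots>)\<close> and so on allow an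
  elimination that removes one block row and one block column at a time. If at each step the leading row
  \<open>(s\<^sub>0, s\<^sub>1, \<dots>)\<close> is first moved to the lower end of the Hurwitz rows that are left, the rows
  collected below are those of a Hankel matrix, in the right order: the matrix \<open>hankel2\<close> if \<open>n\<close> is
  even, and \<open>hankel1\<close> if \<open>n\<close> is odd, when one row \<open>(s\<^sub>0, s\<^sub>1, \<dots>)\<close> is left over
  (\<open>det_hurwitz_hankel\<close>). All signs are \<open>q\<close>-th powers of signs that depend on \<open>n\<close> only, and they
  cancel. Passing to the adjoint conjugates the determinant, which changes nothing because Stieltjes
  positivity makes the Hankel matrix Hermitian.
\<close>

section \<open>Block matrices\<close>

lemma block_matrix_carrier [simp]: "block_matrix q N B \<in> carrier_mat (N * q) (N * q)"
  and dim_row_block_matrix [simp]: "dim_row (block_matrix q N B) = N * q"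
  and dim_col_block_matrix [simp]: "dim_col (block_matrix q N B) = N * q"
  by (simp_all add: block_matrix_def)

lemma block_matrix_index:
  assumes "i < N * q" "k < N * q"
  shows "block_matrix q N B $$ (i, k) = B (i div q) (k div q) $$ (i mod q, k mod q)"
  using assms by (simp add: block_matrix_def)

lemma block_index:
  fixes i N q :: nat
  assumes "i < N * q"
  shows "i div q < N" "i mod q < q"
proof -
  show "i div q < N" using assms by (rule less_mult_imp_div_less)
  from assms have "q > 0" by (cases q) auto
  then show "i mod q < q" by simp
qed

lemma block_matrix_cong:
  assumes "\<And>i k a c. i < N \<Longrightarrow> k < N \<Longrightarrow> a < q \<Longrightarrow> c < q \<Longrightarrow> B i k $$ (a, c) = C i k $$ (a, c)"
  shows "block_matrix q N B = block_matrix q N C"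
proof (rule eq_matI, goal_cases)
  case (1 i k)
  then show ?case
    using block_index [of i N q] block_index [of k N q] by (simp add: block_matrix_index assms)
qed simp_all

lemma sum_block_index:
  fixes f :: "nat \<Rightarrow> 'a :: comm_monoid_add"
  shows "(\<Sum>j<N * q. f j) = (\<Sum>l<N. \<Sum>b<q. f (l * q + b))"
proof -
  have "(\<Sum>j<N * q. f j) = (\<Sum>l<N. \<Sum>j = l * q..<l * q + q. f j)"
    by (rule sum.nat_group [symmetric])
  also have "\<dots> = (\<Sum>l<N. \<Sum>b<q. f (l * q + b))"
  proof (rule sum.cong [OF refl])
    fix l
    show "(\<Sum>j = l * q..<l * q + q. f j) = (\<Sum>b<q. f (l * q + b))"
      using sum.shift_bounds_nat_ivl [of f 0 "l * q" q] by (simp add: lessThan_atLeast0 add.commute)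
  qed
  finally show ?thesis .
qed

lemma prod_block_index:
  fixes f :: "nat \<Rightarrow> 'a :: comm_semiring_1"
  shows "(\<Prod>j<N * q. f (j div q)) = (\<Prod>l<N. f l) ^ q"
proof -
  have "(\<Prod>j<N * q. f (j div q)) = (\<Prod>l<N. \<Prod>j = l * q..<l * q + q. f (j div q))"
    by (rule prod.nat_group [symmetric])
  also have "\<dots> = (\<Prod>l<N. f l ^ q)"
  proof (rule prod.cong [OF refl])
    fix l
    have "j div q = l" if "j \<in> {l * q..<l * q + q}" for j
      using that by (intro div_nat_eqI) (auto simp: mult.commute)
    then have "(\<Prod>j = l * q..<l * q + q. f (j div q)) = (\<Prod>j = l * q..<l * q + q. f l)"
      by (intro prod.cong) auto
    then show "(\<Prod>j = l * q..<l * q + q. f (j div q)) = f l ^ q" by simp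
  qed
  finally show ?thesis by (simp add: prod_power_distrib)
qed

lemma block_matrix_mult:
  "block_matrix q N B * block_matrix q N C =
     block_matrix q N (\<lambda>i k. Matrix.mat q q (\<lambda>(a, c). \<Sum>l<N. \<Sum>b<q. B i l $$ (a, b) * C l k $$ (b, c)))"
proof (rule eq_matI, goal_cases)
  case (1 i k)
  then have i: "i < N * q" and k: "k < N * q" by simp_all
  have bd: "l * q + b < N * q" if "l < N" "b < q" for l b
  proof -
    have "l * q + b < Suc l * q" using that by simp
    also have "\<dots> \<le> N * q" using that by (intro mult_le_mono1) simp
    finally show ?thesis .
  qed
  have "(block_matrix q N B * block_matrix q N C) $$ (i, k)
      = (\<Sum>j<N * q. block_matrix q N B $$ (i, j) * block_matrix q N C $$ (j, k))"
    using i k by (simp add: scalar_prod_def lessThan_atLeast0)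
  also have "\<dots> = (\<Sum>l<N. \<Sum>b<q. B (i div q) l $$ (i mod q, b) * C l (k div q) $$ (b, k mod q))"
    unfolding sum_block_index
    by (intro sum.cong refl) (simp add: block_matrix_index i k bd)
  finally show ?case using i k by (simp add: block_matrix_index block_index)
qed simp_all

section \<open>Adjoints\<close>

lemma mat_adjoint_index [simp]:
  fixes A :: "complex mat"
  assumes "i < dim_col A" "j < dim_row A"
  shows "mat_adjoint A $$ (i, j) = cnj (A $$ (j, i))"
  using assms by (simp add: mat_adjoint_def mat_of_rows_def conjugate_complex_def)

lemma dim_mat_adjoint [simp]:
  "dim_row (mat_adjoint A) = dim_col A" "dim_col (mat_adjoint A) = dim_row A"
  by (simp_all add: mat_adjoint_def)

lemma mat_adjoint_mult:
  fixes A B :: "complex mat"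
  assumes "dim_col A = dim_row B"
  shows "mat_adjoint (A * B) = mat_adjoint B * mat_adjoint A"
  by (rule eq_matI) (use assms in \<open>auto simp: scalar_prod_def cnj_sum mult.commute intro!: sum.cong\<close>)

lemma mat_adjoint_adjoint: "mat_adjoint (mat_adjoint A) = (A :: complex mat)"
  by (rule eq_matI) simp_all

lemma mat_adjoint_block_matrix:
  assumes "\<And>i k. i < N \<Longrightarrow> k < N \<Longrightarrow> B i k \<in> carrier_mat q q"
  shows "mat_adjoint (block_matrix q N B) = block_matrix q N (\<lambda>i k. mat_adjoint (B k i))"
proof (rule eq_matI, goal_cases)
  case (1 i k)
  then have i: "i < N * q" and k: "k < N * q" by simp_all
  have "B (k div q) (i div q) \<in> carrier_mat q q" using i k by (intro assms block_index)
  then show ?case using i k by (simp add: block_matrix_index block_index)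
qed simp_all

lemma det_mat_adjoint:
  fixes A :: "complex mat"
  assumes "A \<in> carrier_mat N N"
  shows "det (mat_adjoint A) = cnj (det A)"
proof -
  interpret cnj: comm_ring_hom cnj by unfold_locales simp_all
  have "mat_adjoint A = transpose_mat (map_mat cnj A)" by (rule eq_matI) simp_all
  then have "det (mat_adjoint A) = det (map_mat cnj A)"
    using det_transpose [of "map_mat cnj A" N] assms by simp
  then show ?thesis by (simp add: cnj.hom_det)
qed

section \<open>Determinants of block matrices\<close>

text \<open>
  Because the diagonal blocks are scalar, such a matrix is lower triangular entry by entry and not
  only block by block, so its determinant is the product of its diagonal entries.
\<close>

lemma det_block_lower_triangular_scalar_diagonal:
  fixes c :: "nat \<Rightarrow> complex"
  assumes "\<And>i k. i < k \<Longrightarrow> k < N \<Longrightarrow> B i k = 0\<^sub>m q q"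
    and "\<And>i. i < N \<Longrightarrow> B i i = c i \<cdot>\<^sub>m 1\<^sub>m q"
  shows "det (block_matrix q N B) = (\<Prod>i<N. c i) ^ q"
proof -
  have "block_matrix q N B $$ (i, j) = 0" if "i < j" "j < N * q" for i j
  proof -
    have ij: "i < N * q" "j < N * q" using that by simp_all
    have "i div q \<le> j div q" using that by (simp add: div_le_mono)
    then consider "i div q < j div q" | "i div q = j div q" by linarith
    then show ?thesis
    proof cases
      case 1
      then show ?thesis using ij by (simp add: block_matrix_index block_index assms(1))
    next
      case 2
      then have "i mod q \<noteq> j mod q" using that by (metis div_mult_mod_eq less_irrefl)
      then show ?thesis using ij 2 by (simp add: block_matrix_index block_index assms(2))
    qed
  qed
  then have "det (block_matrix q N B) = prod_list (diag_mat (block_matrix q N B))"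
    by (intro det_lower_triangular [of "N * q"]) auto
  also have "\<dots> = (\<Prod>i<N * q. block_matrix q N B $$ (i, i))"
    by (simp add: diag_mat_def prod.list_conv_set_nth lessThan_atLeast0)
  also have "\<dots> = (\<Prod>i<N * q. c (i div q))"
    by (intro prod.cong refl) (simp add: block_matrix_index block_index assms(2))
  finally show ?thesis by (simp add: prod_block_index)
qed

lemma det_scale_block_rows:
  fixes c :: "nat \<Rightarrow> complex"
  assumes "\<And>i k. i < N \<Longrightarrow> k < N \<Longrightarrow> B i k \<in> carrier_mat q q"
  shows "det (block_matrix q N (\<lambda>i k. c i \<cdot>\<^sub>m B i k)) = (\<Prod>i<N. c i) ^ q * det (block_matrix q N B)"
proof -
  define D where "D = block_matrix q N (\<lambda>i k. if i = k then c i \<cdot>\<^sub>m 1\<^sub>m q else 0\<^sub>m q q)"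
  have "block_matrix q N (\<lambda>i k. c i \<cdot>\<^sub>m B i k) = D * block_matrix q N B"
    unfolding D_def block_matrix_mult
  proof (rule block_matrix_cong)
    fix i k a e assume *: "i < N" "k < N" "a < q" "e < q"
    have "(\<Sum>l<N. \<Sum>b<q. (if i = l then c i \<cdot>\<^sub>m 1\<^sub>m q else 0\<^sub>m q q) $$ (a, b) * B l k $$ (b, e))
        = (\<Sum>l<N. \<Sum>b<q. if l = i then if b = a then c i * B i k $$ (a, e) else 0 else 0)"
      by (intro sum.cong refl) (use * in auto)
    also have "\<dots> = (\<Sum>l<N. if l = i then c i * B i k $$ (a, e) else 0)"
      by (intro sum.cong refl) (use * in auto)
    also have "\<dots> = c i * B i k $$ (a, e)" using * by simp
    finally show "(c i \<cdot>\<^sub>m B i k) $$ (a, e) = Matrix.mat q q (\<lambda>(a, e). \<Sum>l<N. \<Sum>b<q.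
        (if i = l then c i \<cdot>\<^sub>m 1\<^sub>m q else 0\<^sub>m q q) $$ (a, b) * B l k $$ (b, e)) $$ (a, e)"
      using * assms [of i k] by simp
  qed
  moreover have "det D = (\<Prod>i<N. c i) ^ q"
    unfolding D_def by (rule det_block_lower_triangular_scalar_diagonal) auto
  ultimately show ?thesis
    using det_mult [of D "N * q" "block_matrix q N B"] by (simp add: D_def)
qed

text \<open>
  Moving \<open>q\<close> rows past \<open>j * q\<close> rows costs \<open>j * q\<^sup>2\<close> transpositions of adjacent rows, and \<open>q\<^sup>2\<close> has
  the parity of \<open>q\<close>. On block indices the permutation is the cycle that sends row \<open>0\<close> to row \<open>j\<close>.
\<close>

lemma det_move_first_block_row:
  assumes "j < N"
  shows "det (block_matrix q N B) = (- 1) ^ (q * j) *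
    det (block_matrix q N (\<lambda>i k. B (if i < j then Suc i else if i = j then 0 else i) k))"
proof (cases "q = 0")
  case True
  then show ?thesis by (simp add: det_def)
next
  case False
  have le: "q + j * q \<le> N * q"
    using assms mult_le_mono1 [of "Suc j" N q] by simp
  have "even (q * (j * q)) = even (q * j)" by auto
  then have sgn: "(- 1 :: complex) ^ (q * (j * q)) = (- 1) ^ (q * j)"
    by (metis minus_one_power_iff)
  have "Matrix.mat (N * q) (N * q) (\<lambda>(i, k). block_matrix q N B $$
        (if i < j * q then i + q else if i < q + j * q then i - j * q else i, k))
      = block_matrix q N (\<lambda>i k. B (if i < j then Suc i else if i = j then 0 else i) k)"
    (is "?M = ?B")
  proof (rule eq_matI, goal_cases)
    case (1 i k)
    then have i: "i < N * q" and k: "k < N * q" by simp_all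
    consider "i < j * q" | "j * q \<le> i" "i < q + j * q" | "q + j * q \<le> i" by linarith
    then show ?case
    proof cases
      case 1
      then have "i div q < j" by (rule less_mult_imp_div_less)
      moreover have "i + q < N * q" using 1 le by linarith
      ultimately show ?thesis using 1 i k False by (simp add: block_matrix_index)
    next
      case 2
      then have "i div q = j" by (intro div_nat_eqI) (auto simp: mult.commute)
      moreover from this have "i mod q = i - j * q" by (simp add: modulo_nat_def mult.commute)
      moreover have "i - j * q < N * q" "i - j * q < q" using i 2 by linarith+
      ultimately show ?thesis using 2 i k by (simp add: block_matrix_index)
    next
      case 3
      then have "Suc j \<le> i div q" using False by (simp add: less_eq_div_iff_mult_less_eq)
      then show ?thesis using 3 i k by (simp add: block_matrix_index)
    qed
  qed simp_all
  then show ?thesis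
    using det_swap_initial_rows [of "block_matrix q N B" "N * q" q "j * q"] le sgn by simp
qed

lemma det_delete_unit_block_row:
  assumes "\<And>k. k \<le> N \<Longrightarrow> B 0 k = (if k = 0 then 1\<^sub>m q else 0\<^sub>m q q)"
  shows "det (block_matrix q (Suc N) B) = det (block_matrix q N (\<lambda>i k. B (Suc i) (Suc k)))"
proof -
  define C where "C = Matrix.mat (N * q) q (\<lambda>(i, k). block_matrix q (Suc N) B $$ (i + q, k))"
  have "block_matrix q (Suc N) B
      = four_block_mat (1\<^sub>m q) (0\<^sub>m q (N * q)) C (block_matrix q N (\<lambda>i k. B (Suc i) (Suc k)))"
    (is "?L = ?R")
  proof (rule eq_matI, goal_cases)
    case (1 i k)
    then have i: "i < Suc N * q" and k: "k < Suc N * q" by simp_all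
    have kd: "k div q \<le> N" and km: "k mod q < q" using block_index[OF k] by simp_all
    have nz: "k div q \<noteq> 0" if "\<not> k < q" using that km by (simp add: div_eq_0_iff)
    have shift: "x div q = Suc ((x - q) div q)" "x mod q = (x - q) mod q" if "\<not> x < q" for x
      using that km by (simp_all add: le_div_geq le_mod_geq)
    show ?case
      using i k kd km nz
      by (cases "i < q"; cases "k < q")
         (auto simp: block_matrix_index assms C_def shift)
  qed (simp_all add: C_def)
  then show ?thesis
    using det_four_block_mat_upper_right_zero
      [of "1\<^sub>m q" q "0\<^sub>m q (N * q)" "N * q" C "block_matrix q N (\<lambda>i k. B (Suc i) (Suc k))"]
    by (simp add: C_def)
qed

section \<open>From Hurwitz-like to Hankel determinants\<close>

text \<open>
  Intermediate stages between \<open>cal_L\<close>, stripped of its row signs, and a Hankel matrix. The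
  first \<open>a\<close> block rows are those of the Hurwitz pattern, \<open>(s\<^sub>0, s\<^sub>1, \<dots>)\<close>, \<open>(I, 0, \<dots>)\<close>,
  \<open>(0, s\<^sub>0, s\<^sub>1, \<dots>)\<close>, \<open>(0, I, 0, \<dots>)\<close> and so on; below them stand the Hankel rows
  \<open>(s\<^sub>1, s\<^sub>2, \<dots>)\<close>, \<open>(s\<^sub>2, s\<^sub>3, \<dots>)\<close> and so on. For \<open>a = 0\<close> this is the pattern of \<open>hankel2\<close>. For \<open>a = 1\<close>
  the single remaining Hurwitz row \<open>(s\<^sub>0, s\<^sub>1, \<dots>)\<close> continues the Hankel rows upwards, which gives
  the pattern of \<open>hankel1\<close>.
\<close>

definition hurwitz_hankel_block ::
    "nat \<Rightarrow> (nat \<Rightarrow> complex mat) \<Rightarrow> nat \<Rightarrow> nat \<Rightarrow> nat \<Rightarrow> complex mat" where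
  "hurwitz_hankel_block q s a r k =
     (if r < a then
        if even r then if r div 2 \<le> k then s (k - r div 2) else 0\<^sub>m q q
        else if k = r div 2 then 1\<^sub>m q else 0\<^sub>m q q
      else s (k + Suc (r - a)))"

text \<open>
  Elimination of two Hurwitz rows. The first row \<open>(s\<^sub>0, s\<^sub>1, \<dots>)\<close> is moved down past the other
  \<open>a + 1\<close> Hurwitz rows, to the top of the Hankel rows. Then \<open>(I, 0, \<dots>, 0)\<close> is the first row, and
  expanding along it deletes the first column: the remaining Hurwitz rows lose their leading zero
  block, the moved row becomes \<open>(s\<^sub>1, s\<^sub>2, \<dots>)\<close>, and each old Hankel row is shifted by one, which is
  what the arrival of a new row above it requires.
\<close>

lemma det_hurwitz_hankel_step:
  "det (block_matrix q (Suc (Suc a) + b) (hurwitz_hankel_block q s (Suc (Suc a)))) =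
     (- 1) ^ (q * Suc a) * det (block_matrix q (Suc a + b) (hurwitz_hankel_block q s a))"
proof -
  let ?Y = "hurwitz_hankel_block q s"
  let ?B = "\<lambda>i k. ?Y (Suc (Suc a)) (if i < Suc a then Suc i else if i = Suc a then 0 else i) k"
  have "det (block_matrix q (Suc (Suc a) + b) (?Y (Suc (Suc a)))) =
      (- 1) ^ (q * Suc a) * det (block_matrix q (Suc (Suc a) + b) ?B)"
    by (rule det_move_first_block_row) simp
  also have "det (block_matrix q (Suc (Suc a) + b) ?B) =
      det (block_matrix q (Suc a + b) (\<lambda>i k. ?B (Suc i) (Suc k)))"
    using det_delete_unit_block_row [of "Suc a + b" ?B q]
    by (simp add: hurwitz_hankel_block_def)
  also have "(\<lambda>i k. ?B (Suc i) (Suc k)) = ?Y a"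
  proof (intro ext)
    fix i k
    consider "i < a" | "i = a" | "i > a" by linarith
    then show "?B (Suc i) (Suc k) = ?Y a i k"
      by cases (auto simp: hurwitz_hankel_block_def Suc_diff_le Suc_diff_Suc)
  qed
  finally show ?thesis .
qed

lemma det_hurwitz_hankel:
  "det (block_matrix q (a + 2 * t + b) (hurwitz_hankel_block q s (a + 2 * t))) =
     (- 1) ^ (q * (a + 1) * t) * det (block_matrix q (a + t + b) (hurwitz_hankel_block q s a))"
proof (induction t arbitrary: b)
  case (Suc t)
  have "(- 1 :: complex) ^ (q * Suc (a + 2 * t)) = (- 1) ^ (q * (a + 1))"
    by (auto simp: minus_one_power_iff)
  then show ?case
    using det_hurwitz_hankel_step [of q "a + 2 * t" b s] Suc [of "Suc b"]
    by (simp add: power_add algebra_simps)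
qed simp

section \<open>Inverting matrices of rational functions\<close>

text \<open>
  Gauss-Jordan elimination fails only on singular matrices, so \<open>minv\<close> is specified wherever the
  determinant is nonzero.
\<close>

lemma minv_mult:
  fixes M :: "'a :: field mat"
  assumes "M \<in> carrier_mat q q" "det M \<noteq> 0"
  shows "minv M \<in> carrier_mat q q" "minv M * M = 1\<^sub>m q"
proof -
  have "M \<in> Units (ring_mat TYPE('a) q ())"
    using assms by (rule det_non_zero_imp_unit)
  then obtain B where B: "mat_inverse M = Some B"
    using mat_inverse(1) [OF assms(1), where b = "()"] by (cases "mat_inverse M") auto
  show "minv M \<in> carrier_mat q q" "minv M * M = 1\<^sub>m q"
    using mat_inverse(2) [OF assms(1) B] by (simp_all add: minv_def B)
qed

lemma mpoly_carrier [simp]: "mpoly q N B \<in> carrier_mat q q"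
  by (simp add: mpoly_def)

text \<open>
  The polynomial \<open>w^N * p (1 / w)\<close>, where \<open>p\<close> has the coefficients \<open>f 0, f 1, \<dots>\<close> in descending
  order. It turns statements about \<open>p\<close> near infinity into statements about a polynomial near \<open>0\<close>.
\<close>

definition reversed_poly :: "nat \<Rightarrow> (nat \<Rightarrow> complex) \<Rightarrow> complex poly" where
  "reversed_poly N f = (\<Sum>k\<le>N. monom (f k) k)"

lemma coeff_reversed_poly: "coeff (reversed_poly N f) k = (if k \<le> N then f k else 0)"
  by (simp add: reversed_poly_def coeff_sum if_distrib [of "\<lambda>x. x = _"] cong: if_cong)

lemma poly_reversed_poly:
  assumes "w \<noteq> 0"
  shows "poly (reversed_poly N f) w = w ^ N * poly (\<Sum>k\<le>N. monom (f k) (N - k)) (inverse w)"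
proof -
  have "f k * w ^ k = w ^ N * (f k * inverse w ^ (N - k))" if "k \<le> N" for k
  proof -
    have "w ^ N = w ^ k * w ^ (N - k)" using that by (simp flip: power_add)
    then show ?thesis using assms by (simp add: field_simps)
  qed
  then have "(\<Sum>k\<le>N. f k * w ^ k) = (\<Sum>k\<le>N. w ^ N * (f k * inverse w ^ (N - k)))"
    by (intro sum.cong) auto
  then show ?thesis
    by (simp only: reversed_poly_def poly_sum poly_monom sum_distrib_left)
qed

text \<open>
  At \<open>w = 0\<close> the reversed matrix polynomial is the identity matrix, so its determinant is not the
  zero polynomial. For \<open>w \<noteq> 0\<close> that determinant is a power of \<open>w\<close> times the determinant of the
  original matrix polynomial at \<open>1 / w\<close>, which therefore cannot vanish identically.
\<close>

lemma det_mpoly_monic_nonzero: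
  assumes "B 0 = 1\<^sub>m q"
  shows "det (mpoly q N B) \<noteq> 0"
proof
  assume zero: "det (mpoly q N B) = 0"
  define R where "R = Matrix.mat q q (\<lambda>(i, j). reversed_poly N (\<lambda>k. B k $$ (i, j)))"
  note poly_det = comm_ring_hom.hom_det [OF poly_hom.comm_ring_hom_axioms]
  have "poly (det R) w = 0" if "w \<noteq> 0" for w
  proof -
    have "map_mat (\<lambda>p. poly p w) R = w ^ N \<cdot>\<^sub>m map_mat (\<lambda>p. poly p (inverse w)) (mpoly q N B)"
      by (rule eq_matI) (simp_all add: R_def mpoly_def poly_reversed_poly [OF that])
    then have "poly (det R) w = det (w ^ N \<cdot>\<^sub>m map_mat (\<lambda>p. poly p (inverse w)) (mpoly q N B))"
      by (simp only: poly_det [symmetric])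
    then show ?thesis using zero by (simp add: det_smult poly_det)
  qed
  then have "UNIV - {0} \<subseteq> {w. poly (det R) w = 0}" by auto
  moreover have "infinite (UNIV - {0 :: complex})"
    by (simp add: infinite_UNIV_char_0)
  ultimately have "det R = 0"
    using poly_roots_finite finite_subset by blast
  moreover have "map_mat (\<lambda>p. poly p 0) R = 1\<^sub>m q"
    by (rule eq_matI) (auto simp: R_def poly_0_coeff_0 coeff_reversed_poly assms)
  then have "poly (det R) 0 = 1" by (simp add: poly_det [symmetric])
  ultimately show False by simp
qed

lemma matrix_fraction_mult_denominator:
  assumes "B 0 = 1\<^sub>m q"
  shows "rat_mat (mpoly q d C) * minv (rat_mat (mpoly q N B)) \<in> carrier_mat q q" (is ?carrier)
    and "(rat_mat (mpoly q d C) * minv (rat_mat (mpoly q N B))) * rat_mat (mpoly q N B) =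
      rat_mat (mpoly q d C)" (is ?product)
proof -
  interpret fr: comm_ring_hom "\<lambda>p :: complex poly. Fract p 1"
    by unfold_locales (simp_all add: Zero_fract_def One_fract_def)
  have car: "rat_mat (mpoly q N' B') \<in> carrier_mat q q" for N' B'
    by (simp add: rat_mat_def mpoly_def)
  have "det (rat_mat (mpoly q N B)) = Fract (det (mpoly q N B)) 1"
    unfolding rat_mat_def by (rule fr.hom_det)
  also have "\<dots> \<noteq> 0"
    using det_mpoly_monic_nonzero [of B q N, OF assms]
    unfolding Zero_fract_def by (subst eq_fract) auto
  finally show ?carrier ?product
    using minv_mult [OF car, of N B] car [of d C] car [of N B]
    by (simp_all add: assoc_mult_mat [of _ q q _ q _ q])
qed

section \<open>Comparing Laurent coefficients at infinity\<close>

text \<open>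
  Addition of formal fractions is compatible with evaluation away from the zeros of the given
  denominators. The representative \<open>U / E\<close> has to be produced explicitly, since evaluation is not a
  function on the quotient field.
\<close>

lemma sum_Fract_evaluation:
  fixes u d :: "'b \<Rightarrow> 'a :: field poly"
  assumes "finite I" "\<And>b. b \<in> I \<Longrightarrow> d b \<noteq> 0"
  shows "\<exists>U E. E \<noteq> 0 \<and> (\<Sum>b\<in>I. Fract (u b) (d b)) = Fract U E \<and>
    (\<forall>z. (\<forall>b\<in>I. poly (d b) z \<noteq> 0) \<longrightarrow>
       poly E z \<noteq> 0 \<and> poly U z / poly E z = (\<Sum>b\<in>I. poly (u b) z / poly (d b) z))"
  using assms
proof (induction I rule: finite_induct)
  case empty
  show ?case by (intro exI [of _ 0] exI [of _ 1]) (simp add: Zero_fract_def)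
next
  case (insert c I)
  then obtain U E where UE: "E \<noteq> 0" "(\<Sum>b\<in>I. Fract (u b) (d b)) = Fract U E"
    "\<And>z. (\<forall>b\<in>I. poly (d b) z \<noteq> 0) \<Longrightarrow>
       poly E z \<noteq> 0 \<and> poly U z / poly E z = (\<Sum>b\<in>I. poly (u b) z / poly (d b) z)"
    by auto
  show ?case
  proof (rule exI [of _ "u c * E + U * d c"], rule exI [of _ "d c * E"], rule conjI, goal_cases)
    case 1
    show "d c * E \<noteq> 0" using UE insert.prems by simp
  next
    case 2
    have "(\<Sum>b\<in>insert c I. Fract (u b) (d b)) = Fract (u c * E + U * d c) (d c * E)"
      using UE(1,2) insert.prems insert.hyps by simp
    moreover have "poly (d c * E) z \<noteq> 0 \<and> poly (u c * E + U * d c) z / poly (d c * E) z =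
        (\<Sum>b\<in>insert c I. poly (u b) z / poly (d b) z)"
      if z: "\<forall>b\<in>insert c I. poly (d b) z \<noteq> 0" for z
    proof -
      from z have dc: "poly (d c) z \<noteq> 0"
        and E: "poly E z \<noteq> 0" "poly U z / poly E z = (\<Sum>b\<in>I. poly (u b) z / poly (d b) z)"
        using UE(3) [of z] by auto
      show ?thesis
        using insert.hyps dc E(1) by (simp add: E(2) [symmetric] add_frac_eq)
    qed
    ultimately show ?case by blast
  qed
qed

text \<open>
  Transports an identity in the field of rational functions to an identity between numbers, valid
  for all large \<open>z\<close>: there the series converge and none of the finitely many denominators vanishes.
\<close>

lemma eventually_evaluate_laurent_combination:
  fixes q :: nat
  assumes laurent: "\<And>b. b < q \<Longrightarrow> laurent_at_infinity (x b) (\<alpha> b)"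
    and eq: "(\<Sum>b<q. x b * Fract (h b) 1) = Fract g 1"
  shows "\<forall>\<^sub>F z in at_infinity. \<exists>S. (\<forall>b<q. (\<lambda>j. \<alpha> b j / z ^ (j + 1)) sums S b) \<and>
    (\<Sum>b<q. S b * poly (h b) z) = poly g z"
proof -
  have "\<forall>b. \<exists>p d. b < q \<longrightarrow> d \<noteq> 0 \<and> x b = Fract p d \<and>
      (\<forall>\<^sub>F z in at_infinity. (\<lambda>j. \<alpha> b j / z ^ (j + 1)) sums (poly p z / poly d z))"
    using laurent unfolding laurent_at_infinity_def by blast
  then obtain p d where pd: "\<forall>b. b < q \<longrightarrow> d b \<noteq> 0 \<and> x b = Fract (p b) (d b) \<and>
      (\<forall>\<^sub>F z in at_infinity. (\<lambda>j. \<alpha> b j / z ^ (j + 1)) sums (poly (p b) z / poly (d b) z))"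
    unfolding choice_iff by (elim exE)
  have "\<exists>U E. E \<noteq> 0 \<and> (\<Sum>b<q. Fract (p b * h b) (d b)) = Fract U E \<and>
      (\<forall>z. (\<forall>b\<in>{..<q}. poly (d b) z \<noteq> 0) \<longrightarrow>
         poly E z \<noteq> 0 \<and> poly U z / poly E z = (\<Sum>b<q. poly (p b * h b) z / poly (d b) z))"
    by (rule sum_Fract_evaluation) (use pd in auto)
  then obtain U E where UE: "E \<noteq> 0" "(\<Sum>b<q. Fract (p b * h b) (d b)) = Fract U E"
    and eval: "\<forall>z. (\<forall>b\<in>{..<q}. poly (d b) z \<noteq> 0) \<longrightarrow>
       poly E z \<noteq> 0 \<and> poly U z / poly E z = (\<Sum>b<q. poly (p b * h b) z / poly (d b) z)"
    by (elim exE conjE)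
  have "(\<Sum>b<q. x b * Fract (h b) 1) = (\<Sum>b<q. Fract (p b * h b) (d b))"
    by (intro sum.cong refl) (simp add: pd)
  then have "Fract U E = Fract g 1" using eq UE(2) by simp
  then have U: "U = g * E" using UE(1) by (simp add: eq_fract)
  have "\<forall>\<^sub>F z in at_infinity. \<forall>b\<in>{..<q}.
      (\<lambda>j. \<alpha> b j / z ^ (j + 1)) sums (poly (p b) z / poly (d b) z)"
    using pd by (intro eventually_ball_finite) auto
  moreover have "\<forall>\<^sub>F z in at_infinity. \<forall>b\<in>{..<q}. poly (d b) z \<noteq> 0"
  proof (intro eventually_ball_finite ballI)
    fix b assume "b \<in> {..<q}"
    then have "finite {z. poly (d b) z = 0}" using pd by (intro poly_roots_finite) auto
    then have "bounded {z. poly (d b) z = 0}" by (rule finite_imp_bounded)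
    then obtain M where M: "\<And>z. poly (d b) z = 0 \<Longrightarrow> norm z \<le> M"
      unfolding bounded_iff by auto
    show "\<forall>\<^sub>F z in at_infinity. poly (d b) z \<noteq> 0"
      unfolding eventually_at_infinity using M by (intro exI [of _ "M + 1"]) force
  qed simp
  ultimately show ?thesis
  proof eventually_elim
    case (elim z)
    have "(\<Sum>b<q. poly (p b) z / poly (d b) z * poly (h b) z) = poly g z"
      using spec [OF eval, of z] elim(2) by (auto simp add: U)
    then show ?case
      using elim(1) by (intro exI [of _ "\<lambda>b. poly (p b) z / poly (d b) z"]) auto
  qed
qed

lemma has_fps_expansion_unique:
  fixes F G :: "complex fps"
  assumes F: "f has_fps_expansion F" and G: "g has_fps_expansion G"
    and eq: "\<forall>\<^sub>F w in nhds 0. f w = g w"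
  shows "F = G"
proof (rule eval_fps_eqD)
  show "fps_conv_radius F > 0" "fps_conv_radius G > 0"
    using F G by (simp_all add: has_fps_expansion_def)
  have "\<forall>\<^sub>F w in nhds 0. eval_fps F w = f w" "\<forall>\<^sub>F w in nhds 0. eval_fps G w = g w"
    using F G by (simp_all add: has_fps_expansion_def)
  with eq show "\<forall>\<^sub>F w in nhds 0. eval_fps F w = eval_fps G w"
    by eventually_elim simp
qed

text \<open>
  Substituting \<open>z = 1 / w\<close> and clearing powers of \<open>w\<close> turns the identity into
  \<open>\<Sum>b. F b w * H b w = G w\<close> for small \<open>w \<noteq> 0\<close>, where \<open>F b\<close> is the power series with coefficients
  \<open>\<alpha> b\<close> and \<open>H b\<close>, \<open>G\<close> are the reversed polynomials. The claim is the equality of the coefficients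
  of \<open>w^r\<close>. The vanishing of \<open>h\<close> and \<open>g\<close> beyond the degree bounds makes it hold for all \<open>r\<close>, also
  where \<open>z^(d - r)\<close> is a negative power.
\<close>

lemma laurent_combination_coefficients:
  fixes q :: nat
  assumes laurent: "\<And>b. b < q \<Longrightarrow> laurent_at_infinity (x b) (\<alpha> b)"
    and eq: "(\<Sum>b<q. x b * Fract (\<Sum>k\<le>Suc d. monom (h b k) (Suc d - k)) 1) =
       Fract (\<Sum>k\<le>d. monom (g k) (d - k)) 1"
    and h: "\<And>b k. b < q \<Longrightarrow> k > Suc d \<Longrightarrow> h b k = 0" and g: "\<And>k. k > d \<Longrightarrow> g k = 0"
  shows "g r = (\<Sum>t\<le>r. \<Sum>b<q. \<alpha> b t * h b (r - t))"
proof -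
  define F where "F b = Abs_fps (\<alpha> b)" for b
  define H where "H b = reversed_poly (Suc d) (h b)" for b
  define G where "G = reversed_poly d g"
  have "\<forall>\<^sub>F z in at_infinity. \<exists>S. (\<forall>b<q. (\<lambda>j. \<alpha> b j / z ^ (j + 1)) sums S b) \<and>
      (\<Sum>b<q. S b * poly (\<Sum>k\<le>Suc d. monom (h b k) (Suc d - k)) z) =
        poly (\<Sum>k\<le>d. monom (g k) (d - k)) z" (is "eventually ?E _")
    using laurent eq by (rule eventually_evaluate_laurent_combination)
  moreover have "filterlim inverse at_infinity (at (0 :: complex))"
    by (rule filterlim_inverse_at_infinity)
  ultimately have "\<forall>\<^sub>F w in at 0. ?E (inverse w)"
    by (rule eventually_compose_filterlim)
  moreover have "\<forall>\<^sub>F w in at 0. w \<noteq> (0 :: complex)"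
    by (rule eventually_neq_at_within)
  ultimately have "\<forall>\<^sub>F w in at 0. (\<forall>b<q. summable (\<lambda>j. \<alpha> b j * w ^ j)) \<and>
      (\<Sum>b<q. eval_fps (F b) w * poly (H b) w) = poly G w"
  proof eventually_elim
    case (elim w)
    then obtain S where S: "\<And>b. b < q \<Longrightarrow> (\<lambda>j. \<alpha> b j / inverse w ^ (j + 1)) sums S b"
      and SG: "(\<Sum>b<q. S b * poly (\<Sum>k\<le>Suc d. monom (h b k) (Suc d - k)) (inverse w)) =
        poly (\<Sum>k\<le>d. monom (g k) (d - k)) (inverse w)" by auto
    have w: "w \<noteq> 0" using elim by simp
    have sums: "(\<lambda>j. \<alpha> b j * w ^ j) sums (S b / w)" if "b < q" for b
    proof -
      have "(\<lambda>j. \<alpha> b j / inverse w ^ (j + 1) / w) sums (S b / w)"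
        using S [OF that] by (rule sums_divide)
      also have "(\<lambda>j. \<alpha> b j / inverse w ^ (j + 1) / w) = (\<lambda>j. \<alpha> b j * w ^ j)"
        using w by (simp add: field_simps)
      finally show ?thesis .
    qed
    have "(\<Sum>b<q. eval_fps (F b) w * poly (H b) w)
        = (\<Sum>b<q. w ^ d * (S b * poly (\<Sum>k\<le>Suc d. monom (h b k) (Suc d - k)) (inverse w)))"
    proof (intro sum.cong refl)
      fix b assume "b \<in> {..<q}"
      then have "eval_fps (F b) w = S b / w"
        using sums_unique [OF sums [of b]] by (simp add: eval_fps_def F_def)
      then show "eval_fps (F b) w * poly (H b) w
          = w ^ d * (S b * poly (\<Sum>k\<le>Suc d. monom (h b k) (Suc d - k)) (inverse w))"
        unfolding H_def poly_reversed_poly [OF w] using w by (simp del: sum.atMost_Suc)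
    qed
    also have "\<dots> = poly G w"
      unfolding G_def poly_reversed_poly [OF w] SG [symmetric] by (simp only: sum_distrib_left)
    finally show ?case using sums sums_summable by blast
  qed
  then obtain \<delta> where "\<delta> > 0"
    and \<delta>: "\<And>w. w \<noteq> 0 \<Longrightarrow> norm w < \<delta> \<Longrightarrow> (\<forall>b<q. summable (\<lambda>j. \<alpha> b j * w ^ j)) \<and>
      (\<Sum>b<q. eval_fps (F b) w * poly (H b) w) = poly G w"
    by (auto simp: eventually_at)
  have F: "eval_fps (F b) has_fps_expansion F b" if "b < q" for b
  proof -
    define w :: complex where "w = of_real (\<delta> / 2)"
    have "w \<noteq> 0" "norm w < \<delta>" using \<open>\<delta> > 0\<close> by (simp_all add: w_def)
    then have "conv_radius (\<alpha> b) \<ge> norm w"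
      using \<delta> [of w] that by (intro conv_radius_geI) blast
    then have "fps_conv_radius (F b) > 0"
      using \<open>w \<noteq> 0\<close> by (simp add: fps_conv_radius_def F_def)
        (metis ereal_less(2) less_le_trans zero_less_norm_iff)
    then show ?thesis by (simp add: has_fps_expansion_def)
  qed
  have P: "poly p has_fps_expansion fps_of_poly p" for p :: "complex poly"
    by (simp add: has_fps_expansion_def)
  \<comment> \<open>The extra factor \<open>w\<close> makes the identity hold at \<open>w = 0\<close> as well, hence on a full neighbourhood.\<close>
  let ?L = "\<lambda>w. w * (\<Sum>b<q. eval_fps (F b) w * poly (H b) w)"
  let ?R = "\<lambda>w. w * poly G w"
  have "?L has_fps_expansion fps_X * (\<Sum>b<q. F b * fps_of_poly (H b))"
    by (intro has_fps_expansion_mult has_fps_expansion_sum has_fps_expansion_fps_X F P) auto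
  moreover have "?R has_fps_expansion fps_X * fps_of_poly G"
    by (intro has_fps_expansion_mult has_fps_expansion_fps_X P)
  moreover have "\<forall>\<^sub>F w in nhds 0. ?L w = ?R w"
    unfolding eventually_nhds_metric using \<open>\<delta> > 0\<close> \<delta> by (intro exI [of _ \<delta>]) auto
  ultimately have "fps_X * (\<Sum>b<q. F b * fps_of_poly (H b)) = fps_X * fps_of_poly G"
    by (rule has_fps_expansion_unique)
  then have "(\<Sum>b<q. F b * fps_of_poly (H b)) = fps_of_poly G" by simp
  then have "fps_nth (\<Sum>b<q. F b * fps_of_poly (H b)) r = fps_nth (fps_of_poly G) r" by simp
  moreover have "fps_nth (\<Sum>b<q. F b * fps_of_poly (H b)) r = (\<Sum>b<q. \<Sum>t\<le>r. \<alpha> b t * h b (r - t))"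
    by (auto simp: fps_sum_nth fps_mult_nth F_def H_def coeff_reversed_poly h atLeast0AtMost
        intro!: sum.cong)
  moreover have "fps_nth (fps_of_poly G) r = g r"
    by (simp add: G_def coeff_reversed_poly g)
  ultimately have "g r = (\<Sum>b<q. \<Sum>t\<le>r. \<alpha> b t * h b (r - t))" by simp
  also have "\<dots> = (\<Sum>t\<le>r. \<Sum>b<q. \<alpha> b t * h b (r - t))" by (rule sum.swap)
  finally show ?thesis .
qed

section \<open>The recurrence for the Markov parameters\<close>

text \<open>
  One formula for both parities: with \<open>d = (n - 1) div 2\<close>, the numerator has degree at most \<open>d\<close> and
  the odd-numbered coefficients of \<open>f\<close>, and the denominator is monic of degree \<open>d + 1\<close> with the
  even-numbered ones. For odd \<open>n\<close> the factor \<open>z\<close> in front of \<open>g\<close> raises the degree by one and adds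
  a constant term zero, which agrees with the convention \<open>A\<^sub>r = 0\<close> for \<open>r > n\<close>.
\<close>

lemma rat_fun_conv_mpoly:
  assumes "n \<ge> 2"
  shows "rat_fun q n A =
    rat_mat (mpoly q ((n - 1) div 2) (\<lambda>k. coef q n A (2 * int k + 1))) *
    minv (rat_mat (mpoly q (Suc ((n - 1) div 2)) (\<lambda>k. coef q n A (2 * int k))))"
proof (cases "even n")
  case True
  then obtain m where "n = 2 * m" by blast
  moreover from this assms obtain l where "m = Suc l" by (cases m) auto
  ultimately show ?thesis by (simp add: rat_fun_def h_poly_def g_poly_def)
next
  case False
  then obtain m where n: "n = 2 * m + 1" using oddE by blast
  have top: "coef q n A (2 * int (Suc m)) = 0\<^sub>m q q" by (simp add: coef_def n)
  have shift: "monom 1 1 * (\<Sum>k\<le>m. monom (f k) (m - k)) = (\<Sum>k\<le>Suc m. monom (f k) (Suc m - k))"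
    if "f (Suc m) = 0" for f :: "nat \<Rightarrow> complex"
    using that by (simp add: sum_distrib_left mult_monom Suc_diff_le)
  have "rat_z \<cdot>\<^sub>m rat_mat (mpoly q m (\<lambda>k. coef q n A (2 * int k))) =
      rat_mat (mpoly q (Suc m) (\<lambda>k. coef q n A (2 * int k)))"
  proof (rule eq_matI, goal_cases)
    case (1 i j)
    then have "i < q" "j < q" by (simp_all add: rat_mat_def mpoly_def)
    then show ?case
      using shift [of "\<lambda>k. coef q n A (2 * int k) $$ (i, j)"] top
      by (simp add: rat_mat_def mpoly_def rat_z_def del: sum.atMost_Suc)
  qed (simp_all add: rat_mat_def mpoly_def)
  then show ?thesis by (simp add: rat_fun_def h_poly_def g_poly_def n)
qed

text \<open>
  Multiplying the rational function by its denominator and comparing coefficients gives, entry by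
  entry, \<open>A\<^sub>2\<^sub>r\<^sub>+\<^sub>1 = s\<^sub>0 A\<^sub>2\<^sub>r - s\<^sub>1 A\<^sub>2\<^sub>r\<^sub>-\<^sub>2 + \<dots> + (-1)^r s\<^sub>r A\<^sub>0\<close>. This holds for every \<open>r\<close>, the left side
  being zero once \<open>2 r + 1 > n\<close>.
\<close>

lemma markov_recurrence:
  assumes "n \<ge> 2" "markov_parameters q n A s" and a: "a < q" and c: "c < q"
  shows "coef q n A (2 * int r + 1) $$ (a, c) =
    (\<Sum>t\<le>r. \<Sum>b<q. (- 1) ^ t * s t $$ (a, b) * coef q n A (2 * int (r - t)) $$ (b, c))"
proof -
  define d where "d = (n - 1) div 2"
  let ?B = "\<lambda>k. coef q n A (2 * int k)" and ?C = "\<lambda>k. coef q n A (2 * int k + 1)"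
  let ?H = "rat_mat (mpoly q (Suc d) ?B)" and ?G = "rat_mat (mpoly q d ?C)"
  have dn: "2 * Suc d \<ge> n" unfolding d_def using assms(1) by presburger
  have "rat_fun q n A = ?G * minv ?H"
    unfolding d_def by (rule rat_fun_conv_mpoly) fact
  then have RH: "rat_fun q n A * ?H = ?G" and R: "rat_fun q n A \<in> carrier_mat q q"
    using matrix_fraction_mult_denominator [of ?B q d ?C "Suc d"] by (simp_all add: coef_def)
  show ?thesis
  proof (rule laurent_combination_coefficients)
    show "laurent_at_infinity (rat_fun q n A $$ (a, b)) (\<lambda>t. (- 1) ^ t * s t $$ (a, b))"
      if "b < q" for b
      using assms that by (simp add: markov_parameters_def)
    have "(rat_fun q n A * ?H) $$ (a, c) = ?G $$ (a, c)" by (simp only: RH)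
    then show "(\<Sum>b<q. rat_fun q n A $$ (a, b) *
        Fract (\<Sum>k\<le>Suc d. monom (?B k $$ (b, c)) (Suc d - k)) 1) =
        Fract (\<Sum>k\<le>d. monom (?C k $$ (a, c)) (d - k)) 1"
      using a c R
      by (simp add: scalar_prod_def rat_mat_def mpoly_def lessThan_atLeast0 del: sum.atMost_Suc)
    show "?B k $$ (b, c) = 0" if "b < q" "k > Suc d" for b k
      using that dn c by (auto simp: coef_def)
    show "?C k $$ (a, c) = 0" if "k > d" for k
      using that dn a c by (auto simp: coef_def)
  qed
qed

section \<open>The factorization of the block Hurwitz matrix\<close>

lemma coef_carrier:
  assumes "\<And>j. 1 \<le> j \<Longrightarrow> j \<le> n \<Longrightarrow> A j \<in> carrier_mat q q"
  shows "coef q n A r \<in> carrier_mat q q"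
  using assms by (auto simp: coef_def)

lemma mat_adjoint_cal_A:
  assumes "\<And>r. coef q n A r \<in> carrier_mat q q"
  shows "mat_adjoint (cal_A q n A) = block_matrix q n (\<lambda>l k.
    if l \<le> k then (- 1) ^ l \<cdot>\<^sub>m coef q n A (2 * (int k - int l)) else 0\<^sub>m q q)"
proof -
  let ?B = "\<lambda>l k. if k \<le> l then (- 1) ^ k \<cdot>\<^sub>m mat_adjoint (coef q n A (2 * (int l - int k))) else 0\<^sub>m q q"
  have dims: "dim_row (coef q n A r) = q" "dim_col (coef q n A r) = q" for r
    using assms [of r] by auto
  have "mat_adjoint (cal_A q n A) = block_matrix q n (\<lambda>l k. mat_adjoint (?B k l))"
    unfolding cal_A_def by (rule mat_adjoint_block_matrix) (auto simp: dims)
  also have "\<dots> = block_matrix q n (\<lambda>l k.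
      if l \<le> k then (- 1) ^ l \<cdot>\<^sub>m coef q n A (2 * (int k - int l)) else 0\<^sub>m q q)"
    by (rule block_matrix_cong) (auto simp: dims)
  finally show ?thesis .
qed

text \<open>
  The adjoint of \<open>cal_A\<close> is block upper triangular and carries the sign \<open>(-1)^l\<close> in block row \<open>l\<close>.
  Counting rows from 1, an odd-numbered row of \<open>cal_L\<close> therefore convolves \<open>(-1)^t s\<^sub>t\<close> with
  the even-numbered coefficients, which yields the odd-numbered ones by the recurrence, while an
  even-numbered row merely selects one row of the adjoint of \<open>cal_A\<close>, with its sign cancelled.
\<close>

lemma block_hurwitz_factorization:
  assumes n: "n \<ge> 2" and A: "\<And>j. 1 \<le> j \<Longrightarrow> j \<le> n \<Longrightarrow> A j \<in> carrier_mat q q"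
    and s: "markov_parameters q n A s"
  shows "block_hurwitz q n A = cal_L q n s * mat_adjoint (cal_A q n A)"
proof -
  let ?c = "coef q n A"
  let ?U = "\<lambda>l k. if l \<le> k then (- 1) ^ l \<cdot>\<^sub>m ?c (2 * (int k - int l)) else 0\<^sub>m q q"
  have car: "?c r \<in> carrier_mat q q" for r using A by (rule coef_carrier)
  then have cdims: "dim_row (?c r) = q" "dim_col (?c r) = q" for r by auto
  have sdims: "dim_row (s j) = q" "dim_col (s j) = q" for j
    using s by (auto simp: markov_parameters_def)
  have entry: "?c (2 * int (k + 1) - int (i + 1)) $$ (a, e) =
      (\<Sum>l<n. \<Sum>b<q. cal_L_block q s (i + 1) (l + 1) $$ (a, b) * ?U l k $$ (b, e))"
    if i: "i < n" and k: "k < n" and a: "a < q" and e: "e < q" for i k a e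
  proof (cases "even i")
    case True
    then obtain p where p: "i = 2 * p" by blast
    \<comment> \<open>Counting from 0, an even \<open>i = 2 p\<close> is an odd-numbered row, whose nonzero blocks start in column \<open>p\<close>.\<close>
    define T where "T l = (\<Sum>b<q. (- 1) ^ (l - p) * s (l - p) $$ (a, b) *
      ?c (2 * (int k - int l)) $$ (b, e))" for l
    have "(\<Sum>b<q. cal_L_block q s (i + 1) (l + 1) $$ (a, b) * ?U l k $$ (b, e)) =
        (if p \<le> l \<and> l \<le> k then T l else 0)" for l
    proof (cases "p \<le> l \<and> l \<le> k")
      case True
      have "(- 1 :: complex) ^ p * (- 1) ^ l = (- 1) ^ (l - p)"
        using True by (auto simp: minus_one_power_iff)
      then have sgn: "(- 1 :: complex) ^ p * x * ((- 1) ^ l * y) = (- 1) ^ (l - p) * x * y" for x y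
        by (metis (no_types, opaque_lifting) mult.assoc mult.commute)
      show ?thesis
        using True a e unfolding T_def
        by (simp add: cal_L_block_def p cdims sdims sgn)
    next
      case False
      then show ?thesis
        using a e by (auto simp: cal_L_block_def p cdims sdims)
    qed
    then have "(\<Sum>l<n. \<Sum>b<q. cal_L_block q s (i + 1) (l + 1) $$ (a, b) * ?U l k $$ (b, e)) =
        (\<Sum>l<n. if p \<le> l \<and> l \<le> k then T l else 0)" by simp
    also have "\<dots> = (\<Sum>l\<in>{p..k}. T l)"
      by (rule sum.mono_neutral_cong_right) (use k in auto)
    also have "\<dots> = ?c (2 * int (k + 1) - int (i + 1)) $$ (a, e)"
    proof (cases "p \<le> k")
      case True
      have "(\<Sum>l\<in>{p..k}. T l) = (\<Sum>t\<le>k - p. T (t + p))"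
        using sum.shift_bounds_cl_nat_ivl [of T 0 p "k - p"] True by (simp add: atLeast0AtMost)
      also have "\<dots> = ?c (2 * int (k - p) + 1) $$ (a, e)"
        unfolding markov_recurrence [OF n s a e] T_def
      proof (intro sum.cong refl)
        fix t b assume "t \<in> {..k - p}"
        then have "int k - int (t + p) = int (k - p - t)" using True by auto
        then show "(- 1) ^ (t + p - p) * s (t + p - p) $$ (a, b) *
            ?c (2 * (int k - int (t + p))) $$ (b, e) =
            (- 1) ^ t * s t $$ (a, b) * ?c (2 * int (k - p - t)) $$ (b, e)"
          by (simp only: add_diff_cancel_right')
      qed
      also have "2 * int (k - p) + 1 = 2 * int (k + 1) - int (i + 1)"
        using True by (simp add: p of_nat_diff)
      finally show ?thesis .
    next
      case False
      then show ?thesis using a e by (simp add: coef_def p)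
    qed
    finally show ?thesis ..
  next
    case False
    then obtain p where p: "i = 2 * p + 1" using oddE by blast
    have "(\<Sum>b<q. cal_L_block q s (i + 1) (l + 1) $$ (a, b) * ?U l k $$ (b, e)) =
        (if l = p then (- 1) ^ p * ?U p k $$ (a, e) else 0)" for l
    proof (cases "l = p")
      case True
      have "(\<Sum>b<q. cal_L_block q s (i + 1) (l + 1) $$ (a, b) * ?U l k $$ (b, e)) =
          (\<Sum>b<q. if b = a then (- 1) ^ p * ?U p k $$ (a, e) else 0)"
        using a e True by (intro sum.cong refl) (auto simp: cal_L_block_def p)
      then show ?thesis using a True by simp
    next
      case False
      then show ?thesis
        using a e by (simp add: cal_L_block_def p)
    qed
    then have "(\<Sum>l<n. \<Sum>b<q. cal_L_block q s (i + 1) (l + 1) $$ (a, b) * ?U l k $$ (b, e)) =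
        (- 1) ^ p * ?U p k $$ (a, e)" using i p by simp
    also have "\<dots> = ?c (2 * int (k + 1) - int (i + 1)) $$ (a, e)"
    proof (cases "p \<le> k")
      case True
      have "2 * (int k - int p) = 2 * int (k + 1) - int (i + 1)" by (simp add: p)
      then have "?c (2 * (int k - int p)) $$ (a, e) = ?c (2 * int (k + 1) - int (i + 1)) $$ (a, e)"
        by (rule arg_cong)
      moreover have "(- 1) ^ p * ?U p k $$ (a, e) = ?c (2 * (int k - int p)) $$ (a, e)"
        using True a e by (simp add: cdims flip: mult.assoc power_add)
      ultimately show ?thesis by (rule trans [rotated])
    next
      case False
      then show ?thesis using a e by (simp add: coef_def p)
    qed
    finally show ?thesis ..
  qed
  show ?thesis
    unfolding mat_adjoint_cal_A [OF car] cal_L_def block_hurwitz_def block_matrix_mult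
    by (rule block_matrix_cong) (use entry in simp)
qed

lemma mat_adjoint_block_hurwitz:
  assumes "n \<ge> 2" and "\<And>j. 1 \<le> j \<Longrightarrow> j \<le> n \<Longrightarrow> A j \<in> carrier_mat q q"
    and "markov_parameters q n A s"
  shows "mat_adjoint (block_hurwitz q n A) = cal_A q n A * mat_adjoint (cal_L q n s)"
proof -
  have "dim_col (cal_L q n s) = dim_row (mat_adjoint (cal_A q n A))"
    by (simp add: cal_A_def cal_L_def)
  then show ?thesis
    using block_hurwitz_factorization [OF assms] by (simp add: mat_adjoint_mult mat_adjoint_adjoint)
qed

section \<open>The determinant\<close>

lemma det_cal_A: "det (cal_A q n A) = (\<Prod>k<n. (- 1) ^ k) ^ q"
  unfolding cal_A_def
proof (rule det_block_lower_triangular_scalar_diagonal)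
  have "mat_adjoint (1\<^sub>m q :: complex mat) = 1\<^sub>m q" by (rule eq_matI) auto
  then show "(if i \<le> i then (- 1) ^ i \<cdot>\<^sub>m mat_adjoint (coef q n A (2 * (int i - int i))) else 0\<^sub>m q q)
      = (- 1) ^ i \<cdot>\<^sub>m 1\<^sub>m q" for i
    by (simp add: coef_def)
qed simp

text \<open>
  Up to the sign \<open>(-1)^(r div 2)\<close> of row \<open>r\<close> (0-based), \<open>cal_L\<close> is the stage of the elimination that
  consists of Hurwitz rows only.
\<close>

lemma det_cal_L:
  assumes "\<And>j. s j \<in> carrier_mat q q"
  shows "det (cal_L q n s) =
    (\<Prod>r<n. (- 1) ^ (r div 2)) ^ q * det (block_matrix q n (hurwitz_hankel_block q s n))"
proof -
  have "cal_L q n s =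
      block_matrix q n (\<lambda>r k. (- 1) ^ (r div 2) \<cdot>\<^sub>m hurwitz_hankel_block q s n r k)"
    unfolding cal_L_def
    by (rule block_matrix_cong)
       (auto simp: cal_L_block_def hurwitz_hankel_block_def elim!: evenE oddE)
  moreover have "hurwitz_hankel_block q s n r k \<in> carrier_mat q q" for r k
    using assms by (simp add: hurwitz_hankel_block_def)
  ultimately show ?thesis by (simp add: det_scale_block_rows)
qed

lemma hurwitz_hankel_block_0: "hurwitz_hankel_block q s 0 = (\<lambda>i k. s (i + k + 1))"
  by (intro ext) (simp add: hurwitz_hankel_block_def add.commute)

lemma hurwitz_hankel_block_1: "hurwitz_hankel_block q s 1 = (\<lambda>i k. s (i + k))"
  by (intro ext) (auto simp: hurwitz_hankel_block_def add.commute)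

text \<open>
  The signs of \<open>cal_A\<close> and of the rows of \<open>cal_L\<close>, taken together. Block rows \<open>2 i\<close> and \<open>2 i + 1\<close>
  contribute exponents with the odd sum \<open>2 i + i + (2 i + 1) + i\<close>, so each such pair contributes
  one factor \<open>-1\<close>.
\<close>

lemma sign_product_even:
  "(\<Prod>k<2 * m. (- 1 :: complex) ^ k) * (\<Prod>r<2 * m. (- 1) ^ (r div 2)) = (- 1) ^ m"
  by (induction m) (simp_all add: power_mult_distrib algebra_simps flip: power_add)

lemma sign_product_odd:
  "(\<Prod>k<2 * m + 1. (- 1 :: complex) ^ k) * (\<Prod>r<2 * m + 1. (- 1) ^ (r div 2)) = 1"
  using sign_product_even [of m] by (simp add: algebra_simps flip: power_add)

text \<open>
  Each of the \<open>m\<close> elimination steps moves a block row past an odd number of block rows and so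
  contributes \<open>(-1)^q\<close>; this cancels the signs of \<open>cal_A\<close> and of the rows of \<open>cal_L\<close>.
\<close>

lemma det_cal_A_mult_det_cal_L_even:
  assumes "\<And>j. s j \<in> carrier_mat q q" "m \<ge> 1"
  shows "det (cal_A q (2 * m) A) * det (cal_L q (2 * m) s) = det (hankel2 q s (m - 1))"
proof -
  have "det (block_matrix q (2 * m) (hurwitz_hankel_block q s (2 * m))) =
      (- 1) ^ (q * m) * det (hankel2 q s (m - 1))"
    using det_hurwitz_hankel [of q 0 m 0 s] assms(2)
    by (simp add: hurwitz_hankel_block_0 hankel2_def)
  moreover have "(\<Prod>k<2 * m. (- 1 :: complex) ^ k) ^ q * (\<Prod>r<2 * m. (- 1) ^ (r div 2)) ^ q =
      (- 1) ^ (q * m)"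
    unfolding power_mult_distrib [symmetric] sign_product_even by (simp add: power_mult [symmetric] mult.commute)
  ultimately show ?thesis
    by (simp add: det_cal_A det_cal_L assms(1) flip: mult.assoc power_add)
qed

text \<open>
  In the odd case each elimination step moves a block row past an even number of block rows, so the
  elimination is free of signs, and so is the combined sign of \<open>cal_A\<close> and the rows of \<open>cal_L\<close>: the
  last row \<open>2 m\<close> adds the exponent \<open>2 m + m\<close> to the sign \<open>(-1)^m\<close> of the even case.
\<close>

lemma det_cal_A_mult_det_cal_L_odd:
  assumes "\<And>j. s j \<in> carrier_mat q q"
  shows "det (cal_A q (2 * m + 1) A) * det (cal_L q (2 * m + 1) s) = det (hankel1 q s m)"
proof -
  have "(- 1 :: complex) ^ (q * (1 + 1) * m) = 1" by simp
  then have "det (block_matrix q (2 * m + 1) (hurwitz_hankel_block q s (2 * m + 1))) =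
      det (hankel1 q s m)"
    using det_hurwitz_hankel [of q 1 m 0 s] hurwitz_hankel_block_1 [of q s]
    by (simp add: hankel1_def)
  moreover have "(\<Prod>k<2 * m + 1. (- 1 :: complex) ^ k) ^ q *
      (\<Prod>r<2 * m + 1. (- 1) ^ (r div 2)) ^ q = 1"
    unfolding power_mult_distrib [symmetric] sign_product_odd by simp
  ultimately show ?thesis
    unfolding det_cal_A det_cal_L [OF assms] by (simp only: mult.assoc [symmetric] mult_1_left)
qed

text \<open>
  The determinant of \<open>cal_A\<close> is a sign, hence real, so the conjugate may be written around both
  factors. It disappears once the product is known to be a Hankel determinant, because a Hermitian
  matrix has a real determinant.
\<close>

lemma det_mat_adjoint_block_hurwitz:
  assumes "n \<ge> 2" and "\<And>j. 1 \<le> j \<Longrightarrow> j \<le> n \<Longrightarrow> A j \<in> carrier_mat q q"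
    and "markov_parameters q n A s"
  shows "det (mat_adjoint (block_hurwitz q n A)) = cnj (det (cal_A q n A) * det (cal_L q n s))"
proof -
  have car: "cal_A q n A \<in> carrier_mat (n * q) (n * q)" "cal_L q n s \<in> carrier_mat (n * q) (n * q)"
    by (simp_all add: cal_A_def cal_L_def)
  have "mat_adjoint (cal_A q n A) \<in> carrier_mat (n * q) (n * q)"
    using car by auto
  then have "det (block_hurwitz q n A) = det (cal_L q n s) * cnj (det (cal_A q n A))"
    using car by (simp add: block_hurwitz_factorization [OF assms] det_mult det_mat_adjoint)
  moreover have "cnj (det (cal_A q n A)) = det (cal_A q n A)"
    by (simp add: det_cal_A)
  moreover have "block_hurwitz q n A \<in> carrier_mat (n * q) (n * q)"
    by (simp add: block_hurwitz_def)
  ultimately show ?thesis by (simp add: det_mat_adjoint mult.commute)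
qed

lemma hermitian_pos_def_det_real:
  assumes "hermitian_pos_def N M"
  shows "cnj (det M) = det M"
  using assms det_mat_adjoint [of M N] by (simp add: hermitian_pos_def_def)

theorem theorem7p5:
  fixes q n :: nat and A s :: "nat \<Rightarrow> complex mat"
  assumes "q \<ge> 1" and "n \<ge> 2"
    and "\<And>j. 1 \<le> j \<Longrightarrow> j \<le> n \<Longrightarrow> A j \<in> carrier_mat q q"
    and "HTM q n A"
    and "markov_parameters q n A s"
    and "stieltjes_positive q (n - 1) s"
  shows
    "(\<forall>m. n = 2 * m \<longrightarrow>
        mat_adjoint (block_hurwitz q (2 * m) A)
          = cal_A q (2 * m) A * mat_adjoint (cal_L q (2 * m) s) \<and>
        det (mat_adjoint (block_hurwitz q (2 * m) A)) = det (hankel2 q s (m - 1))) \<and>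
     (\<forall>m. n = 2 * m + 1 \<longrightarrow>
        mat_adjoint (block_hurwitz q (2 * m + 1) A)
          = cal_A q (2 * m + 1) A * mat_adjoint (cal_L q (2 * m + 1) s) \<and>
        det (mat_adjoint (block_hurwitz q (2 * m + 1) A)) = det (hankel1 q s m))"
proof -
  have s: "\<And>j. s j \<in> carrier_mat q q"
    using assms(5) by (simp add: markov_parameters_def)
  note factor = mat_adjoint_block_hurwitz [OF assms(2,3,5)]
  note det = det_mat_adjoint_block_hurwitz [OF assms(2,3,5)]
  show ?thesis
  proof (intro conjI allI impI)
    fix m assume n: "n = 2 * m"
    show "mat_adjoint (block_hurwitz q (2 * m) A) = cal_A q (2 * m) A * mat_adjoint (cal_L q (2 * m) s)"
      using factor n by simp
    have m: "m \<ge> 1" using assms(2) n by simp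
    have "hermitian_pos_def ((m - 1 + 1) * q) (hankel2 q s (m - 1))"
    proof -
      have "2 * (m - 1) + 1 \<le> n - 1" using m n by simp
      then show ?thesis using assms(6) unfolding stieltjes_positive_def by blast
    qed
    then show "det (mat_adjoint (block_hurwitz q (2 * m) A)) = det (hankel2 q s (m - 1))"
      using det det_cal_A_mult_det_cal_L_even [of s q m A, OF s m]
      by (simp add: n hermitian_pos_def_det_real del: complex_cnj_mult)
  next
    fix m assume n: "n = 2 * m + 1"
    show "mat_adjoint (block_hurwitz q (2 * m + 1) A) =
        cal_A q (2 * m + 1) A * mat_adjoint (cal_L q (2 * m + 1) s)"
      using factor n by simp
    have "hermitian_pos_def ((m + 1) * q) (hankel1 q s m)"
      using assms(6) unfolding stieltjes_positive_def n by auto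
    then show "det (mat_adjoint (block_hurwitz q (2 * m + 1) A)) = det (hankel1 q s m)"
      using det det_cal_A_mult_det_cal_L_odd [of s q m A, OF s]
      by (simp add: n hermitian_pos_def_det_real del: complex_cnj_mult)
  qed
qed

end
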